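(* Let $X\subset\mathbb{R}^{p,q}$ be a closed submanifold with $\dim X=p+q-1$. Then $\mathrm{N}^{-1}(\mathcal{V})$ is the degenerate locus of $X$. In particular, $X$ is non-degenerate if and only if $\mathcal{V}\cap \mathrm{N}(X)=\emptyset$, where $\mathrm{N}(X)$ is the image of the Gauss map $\mathrm{N}$ of $X$.
   Context: For integers $p,q\ge 0$ with $p+q\ge1$, $\mathrm{I}_{p,q}$ is the diagonal matrix with first $p$ diagonal entries $-1$ and remaining $q$ entries $1$; the Minkowski space $\mathbb{R}^{p,q}$ is $\mathbb{R}^{p+q}$ with scalar product $\langle u,v\rangle=u^{\top}\mathrm{I}_{p,q}v$ on each tangent space. For $x\in X$, $X_x^{\perp}=\{u\in T_xX:\langle u,v\rangle=0 \text{ for all } v\in T_xX\}$. The degenerate locus of $X$ is $\{x\in X: X_x^\perp\ne\{0\}\}$, and $X$ is non-degenerate if its degenerate locus is empty (i.e. the restriction of $\langle\cdot,\cdot\rangle$ to each $T_xX$ is non-degenerate). For a hypersurface $X$, the Gauss map $\mathrm{N}:X\to \mathrm{Gr}(1,p+q)=\mathbb{P}\mathbb{R}^{p+q}$ sends $x$ to the Euclidean normal line $\mathrm{N}_x(X,\mathbb{R}^{p+q})=\{v\in\mathbb{R}^{p+q}: v^{\top}w=0 \text{ for all } w\in T_xX\}$. The quadric $\mathcal{V}\subset\mathbb{P}\mathbb{R}^{p+q}$ is $\mathcal{V}=\{(x_1,\dots,x_p,y_1,\dots,y_q)\in\mathbb{P}\mathbb{R}^{p+q}: \sum_{j=1}^p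 x_j^2-\sum_{j=1}^q y_j^2=0\}$ (points of $\mathbb{P}\mathbb{R}^{p+q}$ are lines through the origin, written in homogeneous coordinates). *)

theory Defs
  imports "HOL-Analysis.Analysis"
begin

section \<open>Smooth submanifolds of a Euclidean space\<close>

text \<open>\<open>Ck_on k S f\<close>: on the open set \<open>S\<close>, \<open>f\<close> has continuous (iterated directional, hence
  Frechet) derivatives up to order \<open>k\<close>.\<close>

primrec Ck_on :: "nat \<Rightarrow> 'a::euclidean_space set \<Rightarrow> ('a \<Rightarrow> 'b::euclidean_space) \<Rightarrow> bool" where
  "Ck_on 0 S f \<longleftrightarrow> continuous_on S f"
| "Ck_on (Suc k) S f \<longleftrightarrow>
     (\<forall>x\<in>S. f differentiable (at x)) \<and>
     (\<forall>v. Ck_on k S (\<lambda>x. frechet_derivative f (at x) v))"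

definition smooth_on :: "'a::euclidean_space set \<Rightarrow> ('a \<Rightarrow> 'b::euclidean_space) \<Rightarrow> bool" where
  "smooth_on S f \<longleftrightarrow> (\<forall>k. Ck_on k S f)"

text \<open>Embedded submanifolds, by smooth slice charts of the ambient space; \<open>X\<close> need not be a
  closed set.\<close>

definition submanifold :: "nat \<Rightarrow> 'a::euclidean_space set \<Rightarrow> bool" where
  "submanifold d X \<longleftrightarrow>
     (\<forall>x\<in>X. \<exists>U V (\<phi> :: 'a \<Rightarrow> 'a) \<psi> L.
        open U \<and> x \<in> U \<and> open V \<and>
        homeomorphism U V \<phi> \<psi> \<and> smooth_on U \<phi> \<and> smooth_on V \<psi> \<and>
        subspace L \<and> dim L = d \<and>
        \<phi> ` (X \<inter> U) = V \<inter> L)"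

text \<open>\<open>T\<^sub>xX\<close>, as the set of velocities at \<open>x\<close> of smooth curves in \<open>X\<close>.\<close>

definition tangent_space :: "'a::euclidean_space set \<Rightarrow> 'a \<Rightarrow> 'a set" where
  "tangent_space X x =
     {v. \<exists>\<gamma> \<epsilon>. \<epsilon> > 0 \<and> smooth_on {-\<epsilon><..<\<epsilon>} \<gamma> \<and> \<gamma> ` {-\<epsilon><..<\<epsilon>} \<subseteq> X \<and>
              \<gamma> 0 = x \<and> (\<gamma> has_vector_derivative v) (at (0::real))}"

section \<open>Minkowski space\<close>

text \<open>\<open>\<real>\<^sup>p\<^sup>,\<^sup>q\<close> is \<^typ>\<open>real ^ 'n\<close> with \<open>CARD('n) = p + q\<close> and \<open>'n\<close> linearly ordered (an index type such
  as \<open>'p + 'q\<close> would exclude \<open>p = 0\<close> and \<open>q = 0\<close>).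
  The number \<open>q\<close> is then determined by \<open>p\<close>, so the notions below take only \<open>p\<close> as a parameter.\<close>

definition first_indices :: "nat \<Rightarrow> 'n::{finite,linorder} set" where
  "first_indices p = {i. card {j. j < i} < p}"

definition mink_matrix :: "nat \<Rightarrow> real ^ 'n::_ ^ 'n::{finite,linorder}" where
  "mink_matrix p = (\<chi> i j. if i = j then (if i \<in> first_indices p then - 1 else 1) else 0)"

definition mink :: "nat \<Rightarrow> real ^ 'n::_ \<Rightarrow> real ^ 'n::{finite,linorder} \<Rightarrow> real" where
  "mink p u v = u \<bullet> (mink_matrix p *v v)"

definition tangent_perp ::
    "nat \<Rightarrow> (real ^ 'n::{finite,linorder}) set \<Rightarrow> real ^ 'n::_ \<Rightarrow> (real ^ 'n::_) set" where
  "tangent_perp p X x = {u \<in> tangent_space X x. \<forall>v\<in>tangent_space X x. mink p u v = 0}"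

definition degenerate_locus ::
    "nat \<Rightarrow> (real ^ 'n::{finite,linorder}) set \<Rightarrow> (real ^ 'n::_) set" where
  "degenerate_locus p X = {x \<in> X. tangent_perp p X x \<noteq> {0}}"

definition nondegenerate :: "nat \<Rightarrow> (real ^ 'n::{finite,linorder}) set \<Rightarrow> bool" where
  "nondegenerate p X \<longleftrightarrow> degenerate_locus p X = {}"

section \<open>Gauss map and isotropic quadric\<close>

text \<open>Points of projective space are lines through the origin, as sets of vectors.\<close>

definition projective_space :: "'a::euclidean_space set set" where
  "projective_space = {l. subspace l \<and> dim l = 1}"

text \<open>Euclidean normal space; for a hypersurface \<open>X\<close> and \<open>x \<in> X\<close> it is a line.\<close>

definition gauss_map :: "'a::euclidean_space set \<Rightarrow> 'a \<Rightarrow> 'a set" where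
  "gauss_map X x = {v. \<forall>w\<in>tangent_space X x. v \<bullet> w = 0}"

text \<open>\<open>v\<close> is a vector of homogeneous coordinates of the point \<open>l\<close>; the equation is homogeneous, so
  the choice of \<open>v\<close> does not matter.\<close>

definition quadric :: "nat \<Rightarrow> (real ^ 'n::{finite,linorder}) set set" where
  "quadric p =
     {l \<in> projective_space. \<exists>v. v \<noteq> 0 \<and> l = span {v} \<and>
        (\<Sum>i\<in>first_indices p. (v $ i)\<^sup>2) - (\<Sum>i\<in>- first_indices p. (v $ i)\<^sup>2) = 0}"

end

theory Submission
  imports Defs
begin

text \<open>A slice chart \<open>\<phi>\<close> at \<open>x\<close> identifies the tangent space with the preimage of the slice \<open>L\<close> under
  the derivative of \<open>\<phi>\<close>: a velocity of a curve in \<open>X\<close> is mapped into \<open>L\<close> because \<open>L\<close> is closed, and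
  straight lines in \<open>L\<close> pull back to curves in \<open>X\<close>. Hence \<open>T\<^sub>xX\<close> is a hyperplane \<open>n\<^sup>\<bottom>\<close>, and the Gauss
  map sends \<open>x\<close> to the line spanned by \<open>n\<close>. With \<open>J\<close> the diagonal matrix of the scalar product, a
  vector \<open>u\<close> is orthogonal to \<open>T\<^sub>xX\<close> iff \<open>J u\<close> is a multiple of \<open>n\<close>, that is, iff \<open>u\<close> is a multiple of
  \<open>J n\<close>; and \<open>J n\<close> is tangent iff \<open>n \<bullet> J n = 0\<close>, which is the equation of the quadric.\<close>

section \<open>The tangent space of a submanifold\<close>

text \<open>Derivatives at points of an open set depend only on values in that set. This lets a
  formula for a derivative that is valid only on \<open>S\<close> replace the
  \<open>frechet_derivative\<close> term in an induction on \<open>k\<close>.\<close>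

lemma Ck_on_cong:
  assumes "open S" "\<And>x. x \<in> S \<Longrightarrow> f x = g x" "Ck_on k S f"
  shows "Ck_on k S g"
  using assms(2,3)
proof (induction k arbitrary: f g)
  case 0
  then show ?case by (simp cong: continuous_on_cong)
next
  case (Suc k)
  have der: "(g has_derivative frechet_derivative f (at x)) (at x)" if "x \<in> S" for x
    using Suc.prems that assms(1)
    by (metis Ck_on.simps(2) frechet_derivative_works has_derivative_transform_within_open)
  have "Ck_on k S (\<lambda>x. frechet_derivative g (at x) v)" for v
  proof (rule Suc.IH)
    show "Ck_on k S (\<lambda>x. frechet_derivative f (at x) v)"
      using Suc.prems by simp
    show "frechet_derivative f (at x) v = frechet_derivative g (at x) v" if "x \<in> S" for x
      using frechet_derivative_at[OF der[OF that]] by simp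
  qed
  then show ?case
    using der by (auto simp: differentiable_def)
qed

text \<open>By the chain rule, a derivative of the composite is a directional derivative of
  \<open>f\<close> composed with the same line, so the induction closes once \<open>f\<close> is
  arbitrary. It supplies the smoothness of straight lines pulled back through a chart.\<close>

lemma Ck_on_compose_line:
  fixes f :: "'a::euclidean_space \<Rightarrow> 'b::euclidean_space" and S :: "real set"
  assumes "open S" "\<And>t. t \<in> S \<Longrightarrow> a + t *\<^sub>R w \<in> V" "Ck_on k V f"
  shows "Ck_on k S (\<lambda>t. f (a + t *\<^sub>R w))"
  using assms(3)
proof (induction k arbitrary: f)
  case 0
  then show ?case
    using assms(2)
    by (auto intro!: continuous_on_compose2[of V f] continuous_intros)
next
  case (Suc k)
  have der: "((\<lambda>t. f (a + t *\<^sub>R w)) has_derivative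
               (\<lambda>s. frechet_derivative f (at (a + t *\<^sub>R w)) (s *\<^sub>R w))) (at t)"
    if "t \<in> S" for t
  proof -
    have "(f has_derivative frechet_derivative f (at (a + t *\<^sub>R w))) (at (a + t *\<^sub>R w))"
      using Suc.prems assms(2)[OF that] by (simp add: frechet_derivative_works)
    moreover have "((\<lambda>t. a + t *\<^sub>R w) has_derivative (\<lambda>s. s *\<^sub>R w)) (at t)"
      by (auto intro!: derivative_eq_intros)
    ultimately show ?thesis
      by (metis (no_types) has_derivative_compose)
  qed
  have "Ck_on k S (\<lambda>t. frechet_derivative (\<lambda>t. f (a + t *\<^sub>R w)) (at t) s)" for s
  proof (rule Ck_on_cong[OF assms(1)])
    show "Ck_on k S (\<lambda>t. frechet_derivative f (at (a + t *\<^sub>R w)) (s *\<^sub>R w))"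
      using Suc.prems by (intro Suc.IH[of "\<lambda>x. frechet_derivative f (at x) (s *\<^sub>R w)"]) simp
    show "frechet_derivative f (at (a + t *\<^sub>R w)) (s *\<^sub>R w) =
          frechet_derivative (\<lambda>t. f (a + t *\<^sub>R w)) (at t) s" if "t \<in> S" for t
      using frechet_derivative_at[OF der[OF that]] by metis
  qed
  then show ?case
    using der by (auto simp: differentiable_def)
qed

lemma smooth_on_has_derivative:
  assumes "smooth_on S f" "x \<in> S"
  shows "(f has_derivative frechet_derivative f (at x)) (at x)"
proof -
  have "Ck_on (Suc 0) S f" using assms(1) unfolding smooth_on_def by blast
  then show ?thesis using assms(2) by (simp add: frechet_derivative_works)
qed

text \<open>The difference quotients at 0 lie in \<open>L\<close>, and so does their limit.
  Membership is asked only near 0 because a curve in a submanifold stays in the chart domain only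
  for small times.\<close>

lemma has_vector_derivative_in_closed_subspace:
  fixes c :: "real \<Rightarrow> 'a::euclidean_space"
  assumes "(c has_vector_derivative v) (at 0)" "subspace L"
    and "\<forall>\<^sub>F t in at 0. c t \<in> L" "c 0 \<in> L"
  shows "v \<in> L"
proof (rule Lim_in_closed_set)
  show "closed L" using assms(2) by (rule closed_subspace)
  show "\<forall>\<^sub>F t in at 0. (c t - c 0) /\<^sub>R t \<in> L"
    using assms(3)
    by eventually_elim (intro subspace_mul subspace_diff assms(2,4))
  show "((\<lambda>t. (c t - c 0) /\<^sub>R t) \<longlongrightarrow> v) (at 0)"
  proof (rule LIM_zero_cancel, rule tendsto_norm_zero_cancel, rule Lim_transform_eventually)
    show "((\<lambda>t. norm (c t - c 0 - t *\<^sub>R v) / norm t) \<longlongrightarrow> 0) (at 0)"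
      using assms(1) by (simp add: has_vector_derivative_def has_derivative_at)
    have "norm (c t - c 0 - t *\<^sub>R v) / norm t = norm ((c t - c 0) /\<^sub>R t - v)" if "t \<noteq> 0" for t
    proof -
      have "(c t - c 0) /\<^sub>R t - v = (c t - c 0 - t *\<^sub>R v) /\<^sub>R t"
        using that by (simp add: scaleR_diff_right)
      then show ?thesis by (simp add: divide_inverse_commute)
    qed
    then show "\<forall>\<^sub>F t in at 0. norm (c t - c 0 - t *\<^sub>R v) / norm t =
                 norm ((c t - c 0) /\<^sub>R t - v)"
      by (simp add: eventually_at_filter)
  qed
qed simp

lemma tangent_space_submanifold:
  fixes X :: "'a::euclidean_space set"
  assumes "submanifold d X" "x \<in> X"
  shows "subspace (tangent_space X x) \<and> dim (tangent_space X x) = d"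
proof -
  obtain U V and \<phi> \<psi> :: "'a \<Rightarrow> 'a" and L where
    U: "open U" "x \<in> U" and V: "open V" and hom: "homeomorphism U V \<phi> \<psi>"
    and sm: "smooth_on U \<phi>" "smooth_on V \<psi>"
    and L: "subspace L" "dim L = d" and img: "\<phi> ` (X \<inter> U) = V \<inter> L"
    using assms unfolding submanifold_def by meson
  define a where "a = \<phi> x"
  define A where "A = frechet_derivative \<phi> (at x)"
  define B where "B = frechet_derivative \<psi> (at a)"
  have a: "a \<in> V" "a \<in> L" using img assms(2) U(2) by (auto simp: a_def)
  have \<psi>a: "\<psi> a = x" using hom U(2) by (simp add: a_def homeomorphism_apply1)
  have A: "(\<phi> has_derivative A) (at x)"
    using smooth_on_has_derivative[OF sm(1) U(2)] by (simp add: A_def)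
  have B: "(\<psi> has_derivative B) (at a)"
    using smooth_on_has_derivative[OF sm(2) a(1)] by (simp add: B_def)
  have linB: "linear B" using B by (rule has_derivative_linear)
  have "((\<lambda>y. \<psi> (\<phi> y)) has_derivative (\<lambda>v. B (A v))) (at x)"
    using A B by (auto simp: a_def intro: has_derivative_compose)
  moreover have "((\<lambda>y. \<psi> (\<phi> y)) has_derivative (\<lambda>v. v)) (at x)"
    by (rule has_derivative_transform_within_open[OF has_derivative_ident U])
      (use hom in \<open>simp add: homeomorphism_apply1\<close>)
  ultimately have BA: "B (A v) = v" for v
    by (metis has_derivative_unique)
  have linA: "linear A" using A by (rule has_derivative_linear)
  have "surj B" by (metis BA surjI)
  then have injB: "inj B" using linB linear_surjective_imp_injective by blast
  have "tangent_space X x = B ` L"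
  proof (intro equalityI subsetI)
    fix v assume "v \<in> tangent_space X x"
    then obtain \<gamma> \<epsilon> where e: "\<epsilon> > 0" "\<gamma> ` {-\<epsilon><..<\<epsilon>} \<subseteq> X" "\<gamma> 0 = x"
      and d: "(\<gamma> has_vector_derivative v) (at (0::real))"
      unfolding tangent_space_def by blast
    have "((\<lambda>t. \<phi> (\<gamma> t)) has_vector_derivative A v) (at 0)"
    proof -
      have "((\<lambda>t. \<phi> (\<gamma> t)) has_derivative (\<lambda>s. A (s *\<^sub>R v))) (at 0)"
        using has_derivative_compose[of \<gamma> "\<lambda>s. s *\<^sub>R v" 0 UNIV \<phi> A] A d e(3)
        by (simp add: has_vector_derivative_def)
      then show ?thesis
        by (simp add: has_vector_derivative_def linear_cmul[OF linA])
    qed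
    \<comment> \<open>The slice equation speaks only of points of \<open>U\<close>, where continuity
      keeps \<gamma> for small times.\<close>
    moreover have "\<forall>\<^sub>F t in at 0. \<phi> (\<gamma> t) \<in> L"
    proof -
      have "(\<gamma> \<longlongrightarrow> x) (at 0)"
        using has_vector_derivative_continuous[OF d] e(3) by (simp add: continuous_at)
      then have "\<forall>\<^sub>F t in at 0. \<gamma> t \<in> U"
        using U topological_tendstoD by blast
      moreover have "\<forall>\<^sub>F t in at 0. t \<in> {-\<epsilon><..<\<epsilon>}"
        using e(1) by (intro eventually_at_in_open') auto
      ultimately show ?thesis
        by eventually_elim (use img e(2) in blast)
    qed
    moreover have "\<phi> (\<gamma> 0) \<in> L" using a e(3) by (simp add: a_def)
    ultimately have "A v \<in> L"
      using has_vector_derivative_in_closed_subspace[OF _ L(1)] by blast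
    then show "v \<in> B ` L" using BA by (metis imageI)
  next
    fix v assume "v \<in> B ` L"
    then obtain w where w: "w \<in> L" "v = B w" by blast
    have "\<forall>\<^sub>F t in nhds (0::real). a + t *\<^sub>R w \<in> V"
    proof (rule topological_tendstoD[OF _ V])
      have "isCont (\<lambda>t::real. a + t *\<^sub>R w) 0" by (intro continuous_intros)
      then show "((\<lambda>t::real. a + t *\<^sub>R w) \<longlongrightarrow> a) (nhds 0)"
        by (simp add: isCont_def filterlim_at_within_not_equal tendsto_nhds_iff)
    qed (rule a)
    then obtain \<epsilon> where e: "\<epsilon> > 0" "\<And>t. \<bar>t\<bar> < \<epsilon> \<Longrightarrow> a + t *\<^sub>R w \<in> V"
      by (auto simp: eventually_nhds_metric dist_real_def)
    define \<gamma> where "\<gamma> = (\<lambda>t. \<psi> (a + t *\<^sub>R w))"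
    have "smooth_on {-\<epsilon><..<\<epsilon>} \<gamma>"
      using sm(2) e(2) unfolding smooth_on_def \<gamma>_def
      by (auto intro!: Ck_on_compose_line[where V = V])
    moreover have "\<gamma> ` {-\<epsilon><..<\<epsilon>} \<subseteq> X"
    proof
      fix y assume "y \<in> \<gamma> ` {-\<epsilon><..<\<epsilon>}"
      then obtain t where "t \<in> {-\<epsilon><..<\<epsilon>}" "y = \<gamma> t" by blast
      then have t: "\<bar>t\<bar> < \<epsilon>" "y = \<gamma> t" by auto
      have "a + t *\<^sub>R w \<in> V \<inter> L"
        using e(2) t(1) a(2) w(1) L(1) by (simp add: subspace_add subspace_mul)
      \<comment> \<open>Since \<psi> undoes \<phi> on \<open>U\<close>, the point \<open>y\<close>
        is \<open>z\<close> itself.\<close>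
      then obtain z where "z \<in> X \<inter> U" "a + t *\<^sub>R w = \<phi> z" using img by blast
      then show "y \<in> X" using t(2) hom by (simp add: \<gamma>_def homeomorphism_apply1)
    qed
    moreover have "\<gamma> 0 = x" by (simp add: \<gamma>_def \<psi>a)
    moreover have "(\<gamma> has_vector_derivative v) (at 0)"
    proof -
      have "((\<lambda>t. a + t *\<^sub>R w) has_derivative (\<lambda>s. s *\<^sub>R w)) (at (0::real))"
        by (auto intro!: derivative_eq_intros)
      then have "(\<gamma> has_derivative (\<lambda>s. B (s *\<^sub>R w))) (at 0)"
        unfolding \<gamma>_def using B by (auto intro: has_derivative_compose)
      then show ?thesis
        by (simp add: has_vector_derivative_def linear_cmul[OF linB] w(2))
    qed
    ultimately show "v \<in> tangent_space X x"
      unfolding tangent_space_def using e(1) by blast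
  qed
  then show ?thesis
    using linB injB L by (simp add: linear_subspace_image dim_image_eq inj_on_subset)
qed

section \<open>Hyperplanes and the isotropic quadric\<close>

text \<open>A proper subspace lies in some hyperplane; equal dimensions force equality.\<close>

lemma hyperplane_normal:
  fixes T :: "'a::euclidean_space set"
  assumes "subspace T" "dim T = DIM('a) - 1"
  obtains n where "n \<noteq> 0" "T = {w. n \<bullet> w = 0}"
proof -
  have "dim T < DIM('a)" using assms(2) by simp
  then obtain n where n: "n \<noteq> 0" "span T \<subseteq> {w. n \<bullet> w = 0}"
    using lowdim_subset_hyperplane by blast
  have "T = {w. n \<bullet> w = 0}"
  proof (rule subspace_dim_equal)
    show "T \<subseteq> {w. n \<bullet> w = 0}" using n(2) span_superset by blast
    show "dim {w. n \<bullet> w = 0} \<le> dim T" using n(1) assms(2) by (simp add: dim_hyperplane)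
  qed (use assms(1) subspace_hyperplane in auto)
  with n(1) show ?thesis by (rule that)
qed

lemma hyperplane_perp_eq_span:
  fixes n :: "'a::euclidean_space"
  shows "{v. \<forall>w\<in>{w. n \<bullet> w = 0}. v \<bullet> w = 0} = span {n}"
proof (intro equalityI subsetI)
  fix v assume v: "v \<in> {v. \<forall>w\<in>{w. n \<bullet> w = 0}. v \<bullet> w = 0}"
  \<comment> \<open>The component of \<open>v\<close> orthogonal to \<open>n\<close>; it turns out
    to be orthogonal to itself.\<close>
  define w where "w = v - ((n \<bullet> v) / (n \<bullet> n)) *\<^sub>R n"
  have nw: "n \<bullet> w = 0" by (simp add: w_def inner_diff_right)
  then have "v \<bullet> w = 0" using v by simp
  moreover have "w \<bullet> w = v \<bullet> w - ((n \<bullet> v) / (n \<bullet> n)) * (n \<bullet> w)"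
    by (subst (1) w_def) (simp only: inner_diff_left inner_scaleR_left)
  ultimately have "w = 0" using nw by simp
  then have "v = ((n \<bullet> v) / (n \<bullet> n)) *\<^sub>R n" by (simp add: w_def)
  then show "v \<in> span {n}" by (metis span_base span_mul singletonI)
qed (auto simp: span_singleton)

section \<open>The scalar product as a symmetric diagonal involution\<close>

lemma mink_matrix_vector_component:
  "(mink_matrix p *v v) $ i = (if i \<in> first_indices p then - v $ i else v $ i)"
  unfolding mink_matrix_def matrix_vector_mult_def
  by (simp add: if_distrib[of "\<lambda>c. c * _"] cong: if_cong)

lemma mink_matrix_involution: "mink_matrix p *v (mink_matrix p *v v) = v"
  by (simp add: vec_eq_iff mink_matrix_vector_component)

lemma mink_matrix_symmetric: "u \<bullet> (mink_matrix p *v v) = (mink_matrix p *v u) \<bullet> v"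
  by (auto simp: inner_vec_def mink_matrix_vector_component intro!: sum.cong)

lemma mink_self:
  "mink p v v = - ((\<Sum>i\<in>first_indices p. (v $ i)\<^sup>2) - (\<Sum>i\<in>- first_indices p. (v $ i)\<^sup>2))"
proof -
  have "mink p v v = (\<Sum>i\<in>UNIV. if i \<in> first_indices p then - (v $ i)\<^sup>2 else (v $ i)\<^sup>2)"
    unfolding mink_def inner_vec_def
    by (intro sum.cong) (auto simp: mink_matrix_vector_component power2_eq_square)
  then show ?thesis
    by (simp add: sum.If_cases sum_negf)
qed

lemma mink_scaleR_self: "mink p (c *\<^sub>R v) (c *\<^sub>R v) = c\<^sup>2 * mink p v v"
  by (simp add: mink_def matrix_vector_mult_scaleR power2_eq_square)

text \<open>The coordinate vector witnessing membership may differ from \<open>n\<close>, but only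
  by a scalar, whose square factors out of the form. The sign in \<open>mink_self\<close> does not
  affect vanishing.\<close>

lemma span_in_quadric_iff:
  assumes "n \<noteq> 0"
  shows "span {n} \<in> quadric p \<longleftrightarrow> mink p n n = 0"
proof
  assume "span {n} \<in> quadric p"
  then obtain v where v: "v \<noteq> 0" "span {n} = span {v}" "mink p v v = 0"
    by (auto simp: quadric_def mink_self)
  then have "n \<in> span {v}" by (metis span_base singletonI)
  then obtain c where "n = c *\<^sub>R v" by (auto simp: span_singleton)
  then show "mink p n n = 0" using v(3) by (simp add: mink_scaleR_self)
next
  assume "mink p n n = 0"
  moreover have "span {n} \<in> projective_space"
    using assms by (simp add: projective_space_def dim_span subspace_span)
  ultimately show "span {n} \<in> quadric p"
    using assms by (auto simp: quadric_def mink_self)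
qed

lemma hyperplane_degenerate_iff:
  assumes "n \<noteq> 0" "T = {w. n \<bullet> w = 0}"
  shows "{u \<in> T. \<forall>v\<in>T. mink p u v = 0} \<noteq> {0} \<longleftrightarrow> mink p n n = 0"
proof -
  let ?J = "\<lambda>v. mink_matrix p *v v"
  \<comment> \<open>Symmetry moves the matrix onto \<open>u\<close>, leaving Euclidean orthogonality
    to the hyperplane.\<close>
  have perp: "(\<forall>v\<in>T. mink p u v = 0) \<longleftrightarrow> ?J u \<in> span {n}" for u
    using hyperplane_perp_eq_span[of n]
    by (auto simp: mink_def mink_matrix_symmetric assms(2) set_eq_iff)
  have "0 \<in> {u \<in> T. \<forall>v\<in>T. mink p u v = 0}"
    by (simp add: assms(2) mink_def)
  then have "{u \<in> T. \<forall>v\<in>T. mink p u v = 0} \<noteq> {0} \<longleftrightarrow> (\<exists>u\<in>T. u \<noteq> 0 \<and> ?J u \<in> span {n})"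
    unfolding perp by blast
  also have "\<dots> \<longleftrightarrow> mink p n n = 0"
  proof
    assume "\<exists>u\<in>T. u \<noteq> 0 \<and> ?J u \<in> span {n}"
    then obtain u c where u: "u \<in> T" "u \<noteq> 0" "?J u = c *\<^sub>R n"
      by (auto simp: span_singleton)
    then have eq: "u = c *\<^sub>R ?J n"
      by (metis mink_matrix_involution matrix_vector_mult_scaleR)
    \<comment> \<open>This is the tangency condition \<open>n \<bullet> u = 0\<close> after
      substituting for \<open>u\<close>.\<close>
    then have "c * mink p n n = 0"
      using u(1) assms(2) by (simp add: mink_def)
    moreover have "c \<noteq> 0" using eq u(2) by auto
    ultimately show "mink p n n = 0" by simp
  next
    assume "mink p n n = 0"
    then have "?J n \<in> T" by (simp add: assms(2) mink_def)
    moreover have "?J n \<noteq> 0"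
      using assms(1) mink_matrix_involution by (metis matrix_vector_mult_0_right)
    moreover have "?J (?J n) \<in> span {n}"
      by (simp add: mink_matrix_involution span_base)
    ultimately show "\<exists>u\<in>T. u \<noteq> 0 \<and> ?J u \<in> span {n}" by blast
  qed
  finally show ?thesis .
qed

theorem proposition4p17:
  fixes X :: "(real ^ 'n::{finite,linorder}) set" and p q :: nat
  assumes "CARD('n) = p + q"
    and "closed X"
    and "submanifold (p + q - 1) X"
  shows "{x \<in> X. gauss_map X x \<in> quadric p} = degenerate_locus p X \<and>
         (nondegenerate p X \<longleftrightarrow> quadric p \<inter> gauss_map X ` X = {})"
proof -
  have "gauss_map X x \<in> quadric p \<longleftrightarrow> tangent_perp p X x \<noteq> {0}" if x: "x \<in> X" for x
  proof -
    \<comment> \<open>The dimension of the ambient space is \<open>CARD('n) = p + q\<close>, which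
      is positive, so the subtraction in \<open>p + q - 1\<close> is not truncated.\<close>
    obtain n where n: "n \<noteq> 0" "tangent_space X x = {w. n \<bullet> w = 0}"
    proof (rule hyperplane_normal)
      show "subspace (tangent_space X x)"
        and "dim (tangent_space X x) = DIM(real ^ 'n::{finite,linorder}) - 1"
        using tangent_space_submanifold[OF assms(3) x] assms(1) by auto
    qed
    have "gauss_map X x = span {n}"
      unfolding gauss_map_def n(2) by (rule hyperplane_perp_eq_span)
    then show ?thesis
      using span_in_quadric_iff[OF n(1)] hyperplane_degenerate_iff[OF n]
      by (simp add: tangent_perp_def)
  qed
  then have "{x \<in> X. gauss_map X x \<in> quadric p} = degenerate_locus p X"
    by (auto simp: degenerate_locus_def)
  \<comment> \<open>Both sides of the equivalence say that the set just identified is empty.\<close>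
  then show ?thesis
    by (auto simp: nondegenerate_def)
qed

end
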